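(* Let $\mathbf{u}^n_{i,j,k}$ be generated by the full-discrete stochastic multi-symplectic wavelet collocation method for the stochastic Maxwell equations with multiplicative noise, as given in the context. Then the method has the following discrete stochastic multi-symplectic conservation law: for all $n$ and all grid indices $(i,j,k)$, $$\frac{\omega^{n+1}_{i,j,k}-\omega^{n}_{i,j,k}}{\Delta t}+\sum_{i'=i-(\gamma-1)}^{i+(\gamma-1)}(B^x)_{i,i'}(\kappa_x)^{n+1/2}_{i',j,k}+\sum_{j'=j-(\gamma-1)}^{j+(\gamma-1)}(B^y)_{j,j'}(\kappa_y)^{n+1/2}_{i,j',k}+\sum_{k'=k-(\gamma-1)}^{k+(\gamma-1)}(B^z)_{k,k'}(\kappa_z)^{n+1/2}_{i,j,k'}=0,$$ where $$\omega^n_{i,j,k}=\tfrac12\,d\mathbf{u}^n_{i,j,k}\wedge M\,d\mathbf{u}^n_{i,j,k},\qquad(\kappa_x)^{n+1/2}_{i',j,k}=d\mathbf{u}^{n+1/2}_{i,j,k}\wedge K_1\,d\mathbf{u}^{n+1/2}_{i',j,k},$$ $$(\kappa_y)^{n+1/2}_{i,j',k}=d\mathbf{u}^{n+1/2}_{i,j,k}\wedge K_2\,d\mathbf{u}^{n+1/2}_{i,j',k},\qquad(\kappa_z)^{n+1/2}_{i,j,k'}=d\mathbf{u}^{n+1/2}_{i,j,k}\wedge K_3\,d\mathbf{u}^{n+1/2}_{i,j,k'}.$$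
   Context: Grid: the spatial domain is $[0,L_1]\times[0,L_2]\times[0,L_3]$ with $N_s=L_s2^{J_s}$ ($s=1,2,3$) collocation points per direction, $(x_i,y_j,z_k)=(i/2^{J_1},j/2^{J_2},k/2^{J_3})$, $1\le i\le N_1$, $1\le j\le N_2$, $1\le k\le N_3$. Spatial indices are read periodically (modulo $N_1,N_2,N_3$ respectively). $\Delta t>0$ is the time step, $\lambda\ge0$ is a constant, and $v^{n+1/2}=\frac12(v^n+v^{n+1})$. Differentiation matrices: let $\gamma$ be a positive even integer and $\phi$ the Daubechies scaling function of order $\gamma$, satisfying $\phi(x)=\sum_{k=0}^{\gamma-1}h_k\phi(2x-k)$ with $\gamma$ non-vanishing filter coefficients $h_k$. Let $\theta(x)=\int\phi(t)\phi(t-x)\,dt$ be its autocorrelation function; $\gamma$ is such that $\theta$ is differentiable, and $N_s\ge 2\gamma-1$. The matrix $B^y$ is the $N_2\times N_2$ skew-symmetric circulant matrix with entries $$(B^y)_{m,m'}=\begin{cases}2^{J_2}\theta'(m-m'),& m-(\gamma-1)\le m'\le m+(\gamma-1),\\ 2^{J_2}\theta'(-l),& m-m'=N_2-l,\ 1\le l\le\gamma-1,\\ 2^{J_2}\theta'(l),& m'-m=N_2-l,\ 1\le l\le\gamma-1,\\ 0,&\text{otherwise,}\end{cases}$$ and $B^x$ ($N_1\times N_1$, with $J_1$) and $B^z$ ($N_3\times N_3$, with $J_3$) are defined in the same way. Operators on grid functions: $A_1=B^x\otimes I_{N_2}\otimes I_{N_3}$, $A_2=I_{N_1}\otimes B^y\otimes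 I_{N_3}$, $A_3=I_{N_1}\otimes I_{N_2}\otimes B^z$, meaning $(A_1v)_{i,j,k}=\sum_{i'}(B^x)_{i,i'}v_{i',j,k}$, $(A_2v)_{i,j,k}=\sum_{j'}(B^y)_{j,j'}v_{i,j',k}$, $(A_3v)_{i,j,k}=\sum_{k'}(B^z)_{k,k'}v_{i,j,k'}$. The method: for grid functions $\mathbf{E}_1,\mathbf{E}_2,\mathbf{E}_3,\mathbf{H}_1,\mathbf{H}_2,\mathbf{H}_3$, $$\begin{aligned} \mathbf{E}_1^{n+1}-\mathbf{E}_1^{n}&=\Delta t\,(A_2\mathbf{H}_3^{n+1/2}-A_3\mathbf{H}_2^{n+1/2})-\lambda\mathbf{H}_1^{n+1/2}\mathbf{W}^n,\\ \mathbf{E}_2^{n+1}-\mathbf{E}_2^{n}&=\Delta t\,(A_3\mathbf{H}_1^{n+1/2}-A_1\mathbf{H}_3^{n+1/2})-\lambda\mathbf{H}_2^{n+1/2}\mathbf{W}^n,\\ \mathbf{E}_3^{n+1}-\mathbf{E}_3^{n}&=\Delta t\,(A_1\mathbf{H}_2^{n+1/2}-A_2\mathbf{H}_1^{n+1/2})-\lambda\mathbf{H}_3^{n+1/2}\mathbf{W}^n,\\ \mathbf{H}_1^{n+1}-\mathbf{H}_1^{n}&=\Delta t\,(A_3\mathbf{E}_2^{n+1/2}-A_2\mathbf{E}_3^{n+1/2})+\lambda\mathbf{E}_1^{n+1/2}\mathbf{W}^n,\\ \mathbf{H}_2^{n+1}-\mathbf{H}_2^{n}&=\Delta t\,(A_1\mathbf{E}_3^{n+1/2}-A_3\mathbf{E}_1^{n+1/2})+\lambda\mathbf{E}_2^{n+1/2}\mathbf{W}^n,\\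 \mathbf{H}_3^{n+1}-\mathbf{H}_3^{n}&=\Delta t\,(A_2\mathbf{E}_1^{n+1/2}-A_1\mathbf{E}_2^{n+1/2})+\lambda\mathbf{E}_3^{n+1/2}\mathbf{W}^n, \end{aligned}$$ where products with $\mathbf{W}^n$ are componentwise and $(\mathbf{W}^n)_{i,j,k}=\Delta W_i^n$, with $\Delta W_i^n$ a real random variable approximating at the $i$-th grid point in $x$ the increment $W(t_{n+1})-W(t_n)$ of the driving $Q$-Wiener process (which depends spatially only on $x$). The increments do not depend on the discrete solution, so they are constants under the differential $d$ below. Multi-symplectic notation: $\mathbf{u}=(\mathbf{H}_1,\mathbf{H}_2,\mathbf{H}_3,\mathbf{E}_1,\mathbf{E}_2,\mathbf{E}_3)^T$, so $\mathbf{u}^n_{i,j,k}\in\mathbb{R}^6$; $$M=\begin{pmatrix}0&-I_{3}\\ I_{3}&0\end{pmatrix},\quad K_s=\begin{pmatrix}\mathcal{D}_s&0\\0&\mathcal{D}_s\end{pmatrix},\quad \mathcal{D}_1=\begin{pmatrix}0&0&0\\0&0&-1\\0&1&0\end{pmatrix},\ \mathcal{D}_2=\begin{pmatrix}0&0&1\\0&0&0\\-1&0&0\end{pmatrix},\ \mathcal{D}_3=\begin{pmatrix}0&-1&0\\1&0&0\\0&0&0\end{pmatrix}.$$ $d\mathbf{u}^n_{i,j,k}$ is the vector of differentials (one-forms) of the components of $\mathbf{u}^n_{i,j,k}$, viewed pathwise as functions of the initial data; these satisfy the linearized (variational) scheme. For vectors of one-forms $a,b$ and a matrix $R$, $a\wedge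 Rb=\sum_{p,q}R_{pq}\,a_p\wedge b_q$. *)

theory Defs
  imports "HOL-Probability.Probability"
begin

section \<open>Daubechies scaling functions and their autocorrelation\<close>

text \<open>
  The Daubechies filter conditions: normalisation, orthonormality (quadrature mirror filter)
  and \<open>\<gamma>/2\<close> vanishing moments, for a filter with \<open>\<gamma>\<close> non-vanishing coefficients.  They
  determine the filter up to the choice of a spectral factor (extremal phase, least
  asymmetric, ...).  All choices have the same \<open>\<bar>\<Sum>\<^sub>k h\<^sub>k exp(-\<i>k\<xi>)\<bar>\<close>, hence
  the same autocorrelation function \<open>\<theta>\<close>.
\<close>
definition daubechies_filter :: "nat \<Rightarrow> (nat \<Rightarrow> real) \<Rightarrow> bool" where
  "daubechies_filter \<gamma> h \<longleftrightarrow>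
     (\<forall>k<\<gamma>. h k \<noteq> 0) \<and>
     (\<Sum>k<\<gamma>. h k) = 2 \<and>
     (\<forall>m. (\<Sum>k<\<gamma> - 2 * m. h k * h (k + 2 * m)) = (if m = 0 then 2 else 0)) \<and>
     (\<forall>p<\<gamma> div 2. (\<Sum>k<\<gamma>. (- 1) ^ k * real k ^ p * h k) = 0)"

text \<open>
  The scaling function is the normalised, square-integrable solution of the refinement
  equation that vanishes outside \<open>[0, \<gamma> - 1]\<close>.
\<close>
definition daubechies_scaling_function :: "nat \<Rightarrow> (real \<Rightarrow> real) \<Rightarrow> bool" where
  "daubechies_scaling_function \<gamma> \<phi> \<longleftrightarrow>
     (\<exists>h. daubechies_filter \<gamma> h \<and> (\<forall>x. \<phi> x = (\<Sum>k<\<gamma>. h k * \<phi> (2 * x - real k)))) \<and>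
     (\<forall>x. x \<notin> {0..real \<gamma> - 1} \<longrightarrow> \<phi> x = 0) \<and>
     \<phi> \<in> borel_measurable borel \<and>
     integrable lborel (\<lambda>x. (\<phi> x)\<^sup>2) \<and>
     (LINT x|lborel. \<phi> x) = 1"

definition autocorrelation :: "(real \<Rightarrow> real) \<Rightarrow> real \<Rightarrow> real" where
  "autocorrelation \<phi> x = (LINT t|lborel. \<phi> t * \<phi> (t - x))"


section \<open>Periodic grid directions and differentiation matrices\<close>

text \<open>
  The \<open>N\<close> grid points of one direction are the elements of a finite type with
  \<open>N = CARD('n)\<close>, enumerated by a fixed bijection with \<open>{1..N}\<close>.  \<open>grid_pt i\<close> is the
  \<open>i\<close>-th point, with the integer \<open>i\<close> read modulo \<open>N\<close>; \<open>grid_index\<close> is its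
  inverse, with values in \<open>{1..N}\<close>.
\<close>
definition grid_pt :: "int \<Rightarrow> 'n::finite" where
  "grid_pt i = from_nat_into (UNIV :: 'n set) (nat ((i - 1) mod int CARD('n)))"

definition grid_index :: "'n::finite \<Rightarrow> int" where
  "grid_index r = int (to_nat_on (UNIV :: 'n set) r) + 1"

text \<open>
  In the second branch \<open>l = N - (m - m')\<close>, in the third one \<open>l = N - (m' - m)\<close>.
\<close>
definition diff_entry :: "(real \<Rightarrow> real) \<Rightarrow> nat \<Rightarrow> nat \<Rightarrow> int \<Rightarrow> int \<Rightarrow> int \<Rightarrow> real" where
  "diff_entry \<theta> \<gamma> J N m m' =
     (if m - (int \<gamma> - 1) \<le> m' \<and> m' \<le> m + (int \<gamma> - 1)
        then 2 ^ J * deriv \<theta> (of_int (m - m'))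
      else if 1 \<le> N - (m - m') \<and> N - (m - m') \<le> int \<gamma> - 1
        then 2 ^ J * deriv \<theta> (- of_int (N - (m - m')))
      else if 1 \<le> N - (m' - m) \<and> N - (m' - m) \<le> int \<gamma> - 1
        then 2 ^ J * deriv \<theta> (of_int (N - (m' - m)))
      else 0)"

definition diff_matrix :: "(real \<Rightarrow> real) \<Rightarrow> nat \<Rightarrow> nat \<Rightarrow> real^'n^'n::finite" where
  "diff_matrix \<theta> \<gamma> J =
     (\<chi> r s. diff_entry \<theta> \<gamma> J (int CARD('n)) (grid_index r) (grid_index s))"


section \<open>The wavelet collocation method\<close>

text \<open>
  A value of \<open>u = (H\<^sub>1, H\<^sub>2, H\<^sub>3, E\<^sub>1, E\<^sub>2, E\<^sub>3)\<close> is a vector in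
  \<open>real^(3+3)\<close>: the index \<open>Inl s\<close> selects \<open>H\<^sub>s\<close> and \<open>Inr s\<close> selects \<open>E\<^sub>s\<close>.
\<close>
type_synonym ('a, 'b, 'c) grid_scalar = "real^('a \<times> 'b \<times> 'c)"
type_synonym ('a, 'b, 'c) grid_field = "(real^(3 + 3))^('a \<times> 'b \<times> 'c)"

definition Hcomp ::
  "3 \<Rightarrow> ('a::finite, 'b::finite, 'c::finite) grid_field \<Rightarrow> ('a, 'b, 'c) grid_scalar" where
  "Hcomp s U = (\<chi> g. U $ g $ Inl s)"

definition Ecomp ::
  "3 \<Rightarrow> ('a::finite, 'b::finite, 'c::finite) grid_field \<Rightarrow> ('a, 'b, 'c) grid_scalar" where
  "Ecomp s U = (\<chi> g. U $ g $ Inr s)"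

definition op1 ::
  "real^'a^'a \<Rightarrow> ('a::finite, 'b::finite, 'c::finite) grid_scalar \<Rightarrow> ('a, 'b, 'c) grid_scalar" where
  "op1 B v = (\<chi> g. case g of (i, j, k) \<Rightarrow> \<Sum>i'\<in>UNIV. B $ i $ i' * v $ (i', j, k))"

definition op2 ::
  "real^'b^'b \<Rightarrow> ('a::finite, 'b::finite, 'c::finite) grid_scalar \<Rightarrow> ('a, 'b, 'c) grid_scalar" where
  "op2 B v = (\<chi> g. case g of (i, j, k) \<Rightarrow> \<Sum>j'\<in>UNIV. B $ j $ j' * v $ (i, j', k))"

definition op3 ::
  "real^'c^'c \<Rightarrow> ('a::finite, 'b::finite, 'c::finite) grid_scalar \<Rightarrow> ('a, 'b, 'c) grid_scalar" where
  "op3 B v = (\<chi> g. case g of (i, j, k) \<Rightarrow> \<Sum>k'\<in>UNIV. B $ k $ k' * v $ (i, j, k'))"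

definition midpoint_value :: "'v::real_vector \<Rightarrow> 'v \<Rightarrow> 'v" where
  "midpoint_value v v' = (1 / 2) *\<^sub>R (v + v')"

text \<open>
  One time step from \<open>U\<close> to \<open>U'\<close> with noise increments \<open>w\<close>.  The product \<open>*\<close> on
  \<open>real^('a \<times> 'b \<times> 'c)\<close> is the componentwise one.
\<close>
definition wavelet_step ::
  "real \<Rightarrow> real \<Rightarrow> real^'a^'a \<Rightarrow> real^'b^'b \<Rightarrow> real^'c^'c \<Rightarrow> ('a \<Rightarrow> real)
     \<Rightarrow> ('a::finite, 'b::finite, 'c::finite) grid_field \<Rightarrow> ('a, 'b, 'c) grid_field \<Rightarrow> bool" where
  "wavelet_step \<Delta>t lam Bx By Bz w U U' \<longleftrightarrow>
     (let A1 = op1 Bx; A2 = op2 By; A3 = op3 Bz;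
          W = (\<chi> g. case g of (i, j, k) \<Rightarrow> w i);
          E = (\<lambda>s. Ecomp s (midpoint_value U U'));
          H = (\<lambda>s. Hcomp s (midpoint_value U U'))
      in
        Ecomp 1 U' - Ecomp 1 U = \<Delta>t *\<^sub>R (A2 (H 3) - A3 (H 2)) - lam *\<^sub>R (H 1 * W) \<and>
        Ecomp 2 U' - Ecomp 2 U = \<Delta>t *\<^sub>R (A3 (H 1) - A1 (H 3)) - lam *\<^sub>R (H 2 * W) \<and>
        Ecomp 3 U' - Ecomp 3 U = \<Delta>t *\<^sub>R (A1 (H 2) - A2 (H 1)) - lam *\<^sub>R (H 3 * W) \<and>
        Hcomp 1 U' - Hcomp 1 U = \<Delta>t *\<^sub>R (A3 (E 2) - A2 (E 3)) + lam *\<^sub>R (E 1 * W) \<and>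
        Hcomp 2 U' - Hcomp 2 U = \<Delta>t *\<^sub>R (A1 (E 3) - A3 (E 1)) + lam *\<^sub>R (E 2 * W) \<and>
        Hcomp 3 U' - Hcomp 3 U = \<Delta>t *\<^sub>R (A2 (E 1) - A1 (E 2)) + lam *\<^sub>R (E 3 * W))"


section \<open>Multi-symplectic forms\<close>

definition D1 :: "real^3^3" where
  "D1 = vector [vector [0, 0, 0], vector [0, 0, - 1], vector [0, 1, 0]]"

definition D2 :: "real^3^3" where
  "D2 = vector [vector [0, 0, 1], vector [0, 0, 0], vector [- 1, 0, 0]]"

definition D3 :: "real^3^3" where
  "D3 = vector [vector [0, - 1, 0], vector [1, 0, 0], vector [0, 0, 0]]"

definition block_matrix ::
  "real^'n^'m \<Rightarrow> real^'q^'m \<Rightarrow> real^'n^'p \<Rightarrow> real^'q^'p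
     \<Rightarrow> real^('n::finite + 'q::finite)^('m::finite + 'p::finite)" where
  "block_matrix A B C D = (\<chi> r s. case r of
       Inl a \<Rightarrow> (case s of Inl b \<Rightarrow> A $ a $ b | Inr b \<Rightarrow> B $ a $ b)
     | Inr a \<Rightarrow> (case s of Inl b \<Rightarrow> C $ a $ b | Inr b \<Rightarrow> D $ a $ b))"

definition Mmat :: "real^(3 + 3)^(3 + 3)" where
  "Mmat = block_matrix 0 (- mat 1) (mat 1) 0"

definition K1 :: "real^(3 + 3)^(3 + 3)" where "K1 = block_matrix D1 0 0 D1"
definition K2 :: "real^(3 + 3)^(3 + 3)" where "K2 = block_matrix D2 0 0 D2"
definition K3 :: "real^(3 + 3)^(3 + 3)" where "K3 = block_matrix D3 0 0 D3"

text \<open>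
  A one-form at a point of the space \<open>'s\<close> of initial data is a function of one tangent
  vector, a two-form a function of two.  For a field \<open>F\<close> depending on the initial data,
  \<open>differential F v g\<close> is the vector of the differentials, at the initial datum \<open>v\<close>, of
  the components of \<open>F\<close> at the grid point \<open>g\<close>.
\<close>
definition differential ::
  "('s::real_normed_vector \<Rightarrow> (real^'p)^'g) \<Rightarrow> 's \<Rightarrow> 'g::finite \<Rightarrow> ('s \<Rightarrow> real)^'p::finite" where
  "differential F v g = (\<chi> p. frechet_derivative (\<lambda>x. F x $ g $ p) (at v))"

definition wedge :: "('s \<Rightarrow> real) \<Rightarrow> ('s \<Rightarrow> real) \<Rightarrow> 's \<Rightarrow> 's \<Rightarrow> real" where
  "wedge a b \<xi> \<eta> = a \<xi> * b \<eta> - a \<eta> * b \<xi>"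

definition wedge_mat ::
  "('s \<Rightarrow> real)^'p \<Rightarrow> real^'p^'p \<Rightarrow> ('s \<Rightarrow> real)^'p::finite \<Rightarrow> 's \<Rightarrow> 's \<Rightarrow> real" where
  "wedge_mat a R b \<xi> \<eta> = (\<Sum>p\<in>UNIV. \<Sum>q\<in>UNIV. R $ p $ q * wedge (a $ p) (b $ q) \<xi> \<eta>)"

definition omega_form ::
  "('s::real_normed_vector \<Rightarrow> (real^(3 + 3))^'g) \<Rightarrow> 's \<Rightarrow> 'g::finite \<Rightarrow> 's \<Rightarrow> 's \<Rightarrow> real" where
  "omega_form F v g \<xi> \<eta> =
     1 / 2 * wedge_mat (differential F v g) Mmat (differential F v g) \<xi> \<eta>"

text \<open>
  \<open>g\<close> is the grid point at which the conservation law is stated, \<open>g'\<close> the summation point.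
\<close>
definition kappa_form ::
  "real^(3 + 3)^(3 + 3) \<Rightarrow> ('s::real_normed_vector \<Rightarrow> (real^(3 + 3))^'g) \<Rightarrow> 's
     \<Rightarrow> 'g::finite \<Rightarrow> 'g \<Rightarrow> 's \<Rightarrow> 's \<Rightarrow> real" where
  "kappa_form K F v g g' \<xi> \<eta> =
     wedge_mat (differential F v g) K (differential F v g') \<xi> \<eta>"

end

theory Submission
  imports Defs
begin

text \<open>
  The differentiation matrices are skew-symmetric because \<open>\<theta>\<close> is even, so a step preserves
  the norm.  As a step is a linear relation, its result is then uniquely determined and
  \<open>u\<^sup>n\<close> is a linear function of the initial data: the differentials of \<open>u\<^sup>n\<close>
  are \<open>u\<^sup>n\<close> itself, applied to tangent vectors.  The conservation law is the telescoping
  identity \<open>a' b' - a b = (a' - a) b\<^bsub>1/2\<^esub> + a\<^bsub>1/2\<^esub> (b' - b)\<close>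
  applied to \<open>\<omega> = \<Sum>\<^sub>s dE\<^sub>s \<and> dH\<^sub>s\<close>, in which the noise terms cancel.
\<close>

section \<open>Skew-symmetry of the differentiation matrices\<close>

lemma autocorrelation_minus: "autocorrelation \<phi> (- x) = autocorrelation \<phi> x"
proof -
  \<comment> \<open>Translation invariance of Lebesgue measure; the factor \<open>1 *\<close> gives
    the shift by \<open>- x\<close> the affine form of the substitution rule.\<close>
  have "autocorrelation \<phi> (- x) = (LINT t|lborel. \<phi> (- x + 1 * t) * \<phi> ((- x + 1 * t) + x))"
    unfolding autocorrelation_def
    by (subst lborel_integral_real_affine[where c = 1 and t = "- x"]) auto
  then show ?thesis
    by (simp add: autocorrelation_def mult.commute)
qed

text \<open>Reflection carries the derivative at \<open>x\<close> to its negative at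
  \<open>- x\<close>; differentiability ensures that the choice operator \<open>deriv\<close>
  returns a true derivative. The case \<open>x = 0\<close> accounts for the zero diagonal of the
  matrices.\<close>

lemma deriv_even_minus:
  fixes f :: "real \<Rightarrow> real"
  assumes "\<And>x. f (- x) = f x" and "f differentiable (at x)"
  shows "deriv f (- x) = - deriv f x"
proof -
  have "(f has_real_derivative deriv f x) (at x)"
    using assms(2) DERIV_deriv_iff_real_differentiable by blast
  then have "((\<lambda>y. f (- y)) has_real_derivative deriv f x) (at x)"
    by (simp add: assms(1))
  then have "(f has_real_derivative - deriv f x) (at (- x))"
    by (simp add: DERIV_mirror)
  then show ?thesis
    by (rule DERIV_imp_deriv)
qed

text \<open>The bound on \<open>N\<close> keeps the central band and the two wrap-around corners
  disjoint. Exchanging \<open>m\<close> and \<open>m'\<close> preserves the band and swaps the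
  corners, and in each case the argument of \<open>deriv \<theta>\<close> changes sign.\<close>

lemma diff_entry_skew:
  assumes "\<And>x. deriv \<theta> (- x) = - deriv \<theta> x" and "2 * int \<gamma> - 1 \<le> N"
  shows "diff_entry \<theta> \<gamma> J N m' m = - diff_entry \<theta> \<gamma> J N m m'"
proof -
  note odd = assms(1)[of "real_of_int (m - m')"] assms(1)[of "real_of_int (N - (m - m'))"]
    assms(1)[of "real_of_int (N - (m' - m))"]
  show ?thesis
    using odd assms(2) by (auto simp: diff_entry_def)
qed

lemma diff_matrix_skew:
  assumes "\<And>x. deriv \<theta> (- x) = - deriv \<theta> x" and "2 * \<gamma> - 1 \<le> CARD('n::finite)"
  shows "(diff_matrix \<theta> \<gamma> J :: real^'n^'n) $ s $ r = - diff_matrix \<theta> \<gamma> J $ r $ s"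
  unfolding diff_matrix_def vec_lambda_beta
  using assms(2) by (intro diff_entry_skew[OF assms(1)]) linarith

section \<open>Periodic indices and the band of a matrix row\<close>

lemma grid_index_range: "grid_index (r :: 'n::finite) \<in> {1..int CARD('n)}"
  using bspec[OF bij_betwE[OF to_nat_on_finite[OF finite_class.finite_UNIV[where 'a = 'n]]], of r]
  by (simp add: grid_index_def)

lemma grid_pt_index: "grid_pt (grid_index r) = (r :: 'n::finite)"
  using grid_index_range[of r]
  by (simp add: grid_pt_def grid_index_def countable_finite)

lemma grid_index_pt: "grid_index (grid_pt i :: 'n::finite) = (i - 1) mod int CARD('n) + 1"
proof -
  have "nat ((i - 1) mod int CARD('n)) \<in> to_nat_on (UNIV :: 'n set) ` UNIV"
    using bij_betw_imp_surj_on[OF to_nat_on_finite[of "UNIV :: 'n set"]]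
    by (simp add: nat_less_iff)
  then show ?thesis
    by (simp add: grid_index_def grid_pt_def)
qed

lemma grid_pt_periodic: "(grid_pt (i + int CARD('n)) :: 'n::finite) = grid_pt i"
  "(grid_pt (i - int CARD('n)) :: 'n::finite) = grid_pt i"
proof -
  have "(i + int CARD('n) - 1) mod int CARD('n) = (i - 1) mod int CARD('n)"
    using mod_add_self2[of "i - 1" "int CARD('n)"] by (simp add: algebra_simps)
  moreover have "(i - int CARD('n) - 1) mod int CARD('n) = (i - 1) mod int CARD('n)"
    using minus_mod_self2[of "i - 1" "int CARD('n)"] by (simp add: algebra_simps)
  ultimately show "(grid_pt (i + int CARD('n)) :: 'n) = grid_pt i"
    "(grid_pt (i - int CARD('n)) :: 'n) = grid_pt i"
    by (simp_all add: grid_pt_def)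
qed

text \<open>Indices of the same point differ by a multiple of \<open>CARD('n)\<close>, and an
  interval this short leaves room only for the multiple 0.\<close>

lemma inj_on_grid_pt:
  assumes "b - a < int CARD('n::finite)"
  shows "inj_on (grid_pt :: int \<Rightarrow> 'n) {a..b}"
proof (rule inj_onI)
  fix x y assume xy: "x \<in> {a..b}" "y \<in> {a..b}" and "(grid_pt x :: 'n) = grid_pt y"
  then have "(x - 1) mod int CARD('n) = (y - 1) mod int CARD('n)"
    using grid_index_pt[of x, where 'n = 'n] grid_index_pt[of y, where 'n = 'n] by simp
  then have "int CARD('n) dvd x - y"
    by (simp add: mod_eq_dvd_iff)
  moreover have "\<bar>x - y\<bar> < int CARD('n)"
    using xy assms by auto
  ultimately show "x = y"
    using dvd_imp_le_int[of "x - y" "int CARD('n)"] by auto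
qed

text \<open>The window holds \<open>2 * \<gamma> - 1\<close> integers, so it meets no grid point
  twice, and the matrix row vanishes at every point it misses. This turns the banded sums of the
  conservation law into full row sums.\<close>

lemma sum_diff_matrix_band:
  fixes f :: "'n::finite \<Rightarrow> real"
  assumes "\<gamma> > 0" and "2 * \<gamma> - 1 \<le> CARD('n)" and "i \<in> {1..int CARD('n)}"
  shows "(\<Sum>i' = i - (int \<gamma> - 1)..i + (int \<gamma> - 1).
            (diff_matrix \<theta> \<gamma> J :: real^'n^'n) $ grid_pt i $ grid_pt i' * f (grid_pt i'))
       = (\<Sum>r\<in>UNIV. diff_matrix \<theta> \<gamma> J $ grid_pt i $ r * f r)"
proof -
  let ?I = "{i - (int \<gamma> - 1)..i + (int \<gamma> - 1)}"
  have inj: "inj_on (grid_pt :: int \<Rightarrow> 'n) ?I"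
    using assms by (intro inj_on_grid_pt) auto
  have i: "grid_index (grid_pt i :: 'n) = i"
    using assms(3) by (simp add: grid_index_pt)
  have "diff_matrix \<theta> \<gamma> J $ grid_pt i $ r = 0" if r: "r \<notin> grid_pt ` ?I" for r :: 'n
  proof -
    let ?m = "grid_index r"
    have out: "x \<notin> ?I" if "grid_pt x = r" for x
      using r that by blast
    \<comment> \<open>A point missed by the window has all periodic copies of its index outside it.
      The three copies listed rule out the three nonzero branches of \<open>diff_entry\<close>, in
      order.\<close>
    have "?m \<notin> ?I" "?m + int CARD('n) \<notin> ?I" "?m - int CARD('n) \<notin> ?I"
      by (rule out, simp only: grid_pt_periodic grid_pt_index)+
    then show ?thesis
      using assms grid_index_range[of r]
      by (auto simp: diff_matrix_def diff_entry_def i)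
  qed
  then have "(\<Sum>r\<in>grid_pt ` ?I. diff_matrix \<theta> \<gamma> J $ grid_pt i $ r * f r)
      = (\<Sum>r\<in>UNIV. diff_matrix \<theta> \<gamma> J $ grid_pt i $ r * f r)"
    by (intro sum.mono_neutral_left) auto
  then show ?thesis
    by (simp add: sum.reindex[OF inj])
qed

section \<open>Linearity and skew-adjointness of the spatial operators\<close>

lemma linear_op1: "linear (op1 B)"
  by (rule linearI)
    (auto simp: op1_def vec_eq_iff algebra_simps sum.distrib sum_distrib_left split: prod.splits)

lemma linear_op2: "linear (op2 B)"
  by (rule linearI)
    (auto simp: op2_def vec_eq_iff algebra_simps sum.distrib sum_distrib_left split: prod.splits)

lemma linear_op3: "linear (op3 B)"
  by (rule linearI)
    (auto simp: op3_def vec_eq_iff algebra_simps sum.distrib sum_distrib_left split: prod.splits)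

lemma linear_Ecomp: "linear (Ecomp s)"
  by (rule linearI) (auto simp: Ecomp_def vec_eq_iff)

lemma linear_Hcomp: "linear (Hcomp s)"
  by (rule linearI) (auto simp: Hcomp_def vec_eq_iff)

lemma sum_grid:
  "(\<Sum>g\<in>UNIV. f g) = (\<Sum>i\<in>UNIV. \<Sum>j\<in>UNIV. \<Sum>k\<in>UNIV. f (i, j, k))"
  for f :: "'a::finite \<times> 'b::finite \<times> 'c::finite \<Rightarrow> real"
  by (simp add: sum.cartesian_product case_prod_unfold)

text \<open>Summation by parts along one grid line; the operators below apply it with the other two
  indices frozen.\<close>

lemma sum_matrix_skew:
  fixes B :: "real^'n^'n::finite"
  assumes "\<And>r s. B $ s $ r = - B $ r $ s"
  shows "(\<Sum>r\<in>UNIV. (\<Sum>s\<in>UNIV. B $ r $ s * v s) * w r)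
       = - (\<Sum>r\<in>UNIV. v r * (\<Sum>s\<in>UNIV. B $ r $ s * w s))"
proof -
  have "(\<Sum>r\<in>UNIV. (\<Sum>s\<in>UNIV. B $ r $ s * v s) * w r)
      = (\<Sum>s\<in>UNIV. \<Sum>r\<in>UNIV. B $ r $ s * v s * w r)"
    unfolding sum_distrib_right by (rule sum.swap)
  also have "\<dots> = (\<Sum>s\<in>UNIV. \<Sum>r\<in>UNIV. - (v s * (B $ s $ r * w r)))"
    by (intro sum.cong refl) (subst assms, simp)
  finally show ?thesis
    by (simp add: sum_negf sum_distrib_left)
qed

lemma op1_skew:
  fixes v w :: "('a::finite, 'b::finite, 'c::finite) grid_scalar"
  assumes "\<And>r s. B $ s $ r = - B $ r $ s"
  shows "op1 B v \<bullet> w = - (v \<bullet> op1 B w)"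
proof -
  \<comment> \<open>The sum over the differentiated direction is moved innermost, where
    \<open>sum_matrix_skew\<close> applies; for \<open>op3\<close> it is there already.\<close>
  have 1: "(\<Sum>i\<in>UNIV. \<Sum>j\<in>UNIV. \<Sum>k\<in>UNIV. f i j k) = (\<Sum>j\<in>UNIV. \<Sum>k\<in>UNIV. \<Sum>i\<in>UNIV. f i j k)"
    for f :: "'a \<Rightarrow> 'b \<Rightarrow> 'c \<Rightarrow> real"
    by (subst sum.swap) (intro sum.cong refl sum.swap)
  show ?thesis
    by (simp add: inner_vec_def sum_grid op1_def 1 sum_matrix_skew[OF assms] sum_negf)
qed

lemma op2_skew:
  fixes v w :: "('a::finite, 'b::finite, 'c::finite) grid_scalar"
  assumes "\<And>r s. B $ s $ r = - B $ r $ s"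
  shows "op2 B v \<bullet> w = - (v \<bullet> op2 B w)"
proof -
  have 1: "(\<Sum>i\<in>UNIV. \<Sum>j\<in>UNIV. \<Sum>k\<in>UNIV. f i j k) = (\<Sum>i\<in>UNIV. \<Sum>k\<in>UNIV. \<Sum>j\<in>UNIV. f i j k)"
    for f :: "'a \<Rightarrow> 'b \<Rightarrow> 'c \<Rightarrow> real"
    by (intro sum.cong refl sum.swap)
  show ?thesis
    by (simp add: inner_vec_def sum_grid op2_def 1 sum_matrix_skew[OF assms] sum_negf)
qed

lemma op3_skew:
  fixes v w :: "('a::finite, 'b::finite, 'c::finite) grid_scalar"
  assumes "\<And>r s. B $ s $ r = - B $ r $ s"
  shows "op3 B v \<bullet> w = - (v \<bullet> op3 B w)"
  by (simp add: inner_vec_def sum_grid op3_def sum_matrix_skew[OF assms] sum_negf)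

lemma sum_UNIV_sum:
  "(\<Sum>p\<in>UNIV. f p) = (\<Sum>s\<in>UNIV. f (Inl s)) + (\<Sum>s\<in>UNIV. f (Inr s))"
  for f :: "'m::finite + 'n::finite \<Rightarrow> real"
  unfolding UNIV_Plus_UNIV[symmetric] by (subst sum.Plus) auto

lemma inner_grid_field:
  "U \<bullet> V = (\<Sum>s\<in>UNIV. Ecomp s U \<bullet> Ecomp s V + Hcomp s U \<bullet> Hcomp s V)"
  for U V :: "('a::finite, 'b::finite, 'c::finite) grid_field"
  by (simp add: inner_vec_def Ecomp_def Hcomp_def sum_UNIV_sum sum_3 sum.distrib)

text \<open>Makes the noise contributions of the E and H equations to the energy balance
  cancel.\<close>

lemma inner_vec_mult_swap: "(x * w) \<bullet> y = (y * w) \<bullet> (x :: real^'n::finite)"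
  by (simp add: inner_vec_def algebra_simps)

section \<open>One step as a norm-preserving linear relation\<close>

lemma wavelet_step_add:
  assumes "wavelet_step \<Delta>t lam Bx By Bz w U U'" and "wavelet_step \<Delta>t lam Bx By Bz w V V'"
  shows "wavelet_step \<Delta>t lam Bx By Bz w (U + V) (U' + V')"
proof -
  have "midpoint_value (U + V) (U' + V') = midpoint_value U U' + midpoint_value V V'"
    by (simp add: midpoint_value_def algebra_simps)
  then show ?thesis
    unfolding wavelet_step_def Let_def
    by (simp only: linear_add[OF linear_Ecomp] linear_add[OF linear_Hcomp] add_diff_add
        assms[unfolded wavelet_step_def Let_def])
      (simp add: linear_add[OF linear_op1] linear_add[OF linear_op2] linear_add[OF linear_op3]
        algebra_simps)
qed

lemma wavelet_step_scaleR:
  fixes U :: "('a::finite, 'b::finite, 'c::finite) grid_field"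
  assumes "wavelet_step \<Delta>t lam Bx By Bz w U U'"
  shows "wavelet_step \<Delta>t lam Bx By Bz w (c *\<^sub>R U) (c *\<^sub>R U')"
proof -
  have "midpoint_value (c *\<^sub>R U) (c *\<^sub>R U') = c *\<^sub>R midpoint_value U U'"
    by (simp add: midpoint_value_def algebra_simps)
  moreover have "(c *\<^sub>R x) * y = c *\<^sub>R (x * y)" for x y :: "('a, 'b, 'c) grid_scalar"
    by (simp add: vec_eq_iff)
  ultimately show ?thesis
    unfolding wavelet_step_def Let_def
    by (simp only: linear_cmul[OF linear_Ecomp] linear_cmul[OF linear_Hcomp]
        scaleR_diff_right[symmetric] assms[unfolded wavelet_step_def Let_def])
      (simp add: linear_cmul[OF linear_op1] linear_cmul[OF linear_op2] linear_cmul[OF linear_op3]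
        algebra_simps)
qed

text \<open>Testing the increment \<open>U' - U\<close> with the midpoint gives half the change of
  the squared norm. The curl terms cancel in pairs by skew-adjointness, the noise terms by symmetry
  of the componentwise product.\<close>

lemma wavelet_step_norm:
  assumes step: "wavelet_step \<Delta>t lam Bx By Bz w U U'"
    and skew: "\<And>r s. Bx $ s $ r = - Bx $ r $ s" "\<And>r s. By $ s $ r = - By $ r $ s"
      "\<And>r s. Bz $ s $ r = - Bz $ r $ s"
  shows "norm U' = norm U"
proof -
  let ?m = "midpoint_value U U'"
  define E where "E s = Ecomp s ?m" for s
  define H where "H s = Hcomp s ?m" for s
  \<comment> \<open>Skewness combined with symmetry of the inner product, so that the operator stays
    on the left. Used only from \<open>E\<close> to \<open>H\<close>, it brings all mixed terms to
    one normal form.\<close>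
  have s1: "op1 Bx x \<bullet> y = - (op1 Bx y \<bullet> x)" for x y
    by (metis op1_skew[OF skew(1)] inner_commute)
  have s2: "op2 By x \<bullet> y = - (op2 By y \<bullet> x)" for x y
    by (metis op2_skew[OF skew(2)] inner_commute)
  have s3: "op3 Bz x \<bullet> y = - (op3 Bz y \<bullet> x)" for x y
    by (metis op3_skew[OF skew(3)] inner_commute)
  have "(U' - U) \<bullet> ?m = (\<Sum>s\<in>UNIV. (Ecomp s U' - Ecomp s U) \<bullet> E s + (Hcomp s U' - Hcomp s U) \<bullet> H s)"
    by (simp add: inner_grid_field E_def H_def linear_diff[OF linear_Ecomp] linear_diff[OF linear_Hcomp])
  also have "\<dots> = 0"
    unfolding sum_3
    by (simp only: step[unfolded wavelet_step_def Let_def, folded E_def H_def])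
      (simp add: inner_add_left inner_diff_left
        inner_vec_mult_swap[of "H _" _ "E _"] right_diff_distrib distrib_left
        s1[of "E _" "H _"] s2[of "E _" "H _"] s3[of "E _" "H _"])
  finally have "(U' - U) \<bullet> (U' + U) = 0"
    by (simp add: midpoint_value_def add.commute)
  then have "U' \<bullet> U' = U \<bullet> U"
    by (simp add: algebra_simps inner_commute)
  then show ?thesis
    by (simp add: norm_eq_sqrt_inner)
qed

text \<open>The difference of two results is the result of a step from 0, hence has norm 0.\<close>

lemma wavelet_step_unique:
  assumes "wavelet_step \<Delta>t lam Bx By Bz w U V" and "wavelet_step \<Delta>t lam Bx By Bz w U V'"
    and skew: "\<And>r s. Bx $ s $ r = - Bx $ r $ s" "\<And>r s. By $ s $ r = - By $ r $ s"
      "\<And>r s. Bz $ s $ r = - Bz $ r $ s"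
  shows "V = V'"
proof -
  have "wavelet_step \<Delta>t lam Bx By Bz w (U + (- 1) *\<^sub>R U) (V + (- 1) *\<^sub>R V')"
    by (intro wavelet_step_add wavelet_step_scaleR assms)
  from wavelet_step_norm[OF this skew] show ?thesis
    by simp
qed

text \<open>Linear combinations of results solve the step from the combined data, so uniqueness
  forces any solution map \<open>G\<close> to be linear.\<close>

lemma wavelet_step_linear:
  assumes "linear F" and "\<And>v. wavelet_step \<Delta>t lam Bx By Bz w (F v) (G v)"
    and skew: "\<And>r s. Bx $ s $ r = - Bx $ r $ s" "\<And>r s. By $ s $ r = - By $ r $ s"
      "\<And>r s. Bz $ s $ r = - Bz $ r $ s"
  shows "linear G"
proof (rule linearI)
  fix x y
  have "wavelet_step \<Delta>t lam Bx By Bz w (F (x + y)) (G x + G y)"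
    unfolding linear_add[OF assms(1)] by (intro wavelet_step_add assms)
  then show "G (x + y) = G x + G y"
    using wavelet_step_unique[OF assms(2) _ skew] by blast
next
  fix c x
  have "wavelet_step \<Delta>t lam Bx By Bz w (F (c *\<^sub>R x)) (c *\<^sub>R G x)"
    unfolding linear_cmul[OF assms(1)] by (intro wavelet_step_scaleR assms)
  then show "G (c *\<^sub>R x) = c *\<^sub>R G x"
    using wavelet_step_unique[OF assms(2) _ skew] by blast
qed

section \<open>Differentials of linear fields and the two-forms in components\<close>

lemma differential_linear:
  fixes F :: "'s::euclidean_space \<Rightarrow> (real^'p)^'g::finite"
  assumes "linear F"
  shows "differential F v g $ p = (\<lambda>x. F x $ g $ p)"
proof -
  have "linear (\<lambda>x. F x $ g $ p)"
    by (rule linearI) (simp_all add: linear_add[OF assms] linear_cmul[OF assms])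
  \<comment> \<open>In finite dimension a linear map is bounded, hence its own derivative at every
    base point \<open>v\<close>.\<close>
  then have "((\<lambda>x. F x $ g $ p) has_derivative (\<lambda>x. F x $ g $ p)) (at v)"
    by (intro bounded_linear_imp_has_derivative) (simp add: linear_conv_bounded_linear)
  then show ?thesis
    by (simp add: differential_def frechet_derivative_at[symmetric])
qed

lemma D1_nth: "D1 $ p $ q = (if p = 2 \<and> q = 3 then - 1 else if p = 3 \<and> q = 2 then 1 else 0)"
  using exhaust_3[of p] exhaust_3[of q] by (auto simp: D1_def)

lemma D2_nth: "D2 $ p $ q = (if p = 1 \<and> q = 3 then 1 else if p = 3 \<and> q = 1 then - 1 else 0)"
  using exhaust_3[of p] exhaust_3[of q] by (auto simp: D2_def)

lemma D3_nth: "D3 $ p $ q = (if p = 1 \<and> q = 2 then - 1 else if p = 2 \<and> q = 1 then 1 else 0)"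
  using exhaust_3[of p] exhaust_3[of q] by (auto simp: D3_def)

text \<open>Both off-diagonal blocks contribute equally by antisymmetry of \<open>wedge\<close>; the
  resulting 2 cancels the 1/2 in \<open>omega_form\<close>.\<close>

lemma wedge_mat_Mmat:
  "wedge_mat a Mmat a \<xi> \<eta> = 2 * (\<Sum>s\<in>UNIV. wedge (a $ Inr s) (a $ Inl s) \<xi> \<eta>)"
  by (simp add: wedge_mat_def Mmat_def block_matrix_def sum_UNIV_sum sum_3 mat_def wedge_def)

text \<open>\<open>D1\<close> is the cross product with the first unit vector, so only components 2
  and 3 of each block enter; \<open>K2\<close> and \<open>K3\<close> are analogous.\<close>

lemma wedge_mat_K1:
  "wedge_mat a K1 b \<xi> \<eta> =
     wedge (a $ Inl 3) (b $ Inl 2) \<xi> \<eta> - wedge (a $ Inl 2) (b $ Inl 3) \<xi> \<eta>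
   + wedge (a $ Inr 3) (b $ Inr 2) \<xi> \<eta> - wedge (a $ Inr 2) (b $ Inr 3) \<xi> \<eta>"
  by (simp add: wedge_mat_def K1_def block_matrix_def sum_UNIV_sum sum_3 D1_nth)

lemma wedge_mat_K2:
  "wedge_mat a K2 b \<xi> \<eta> =
     wedge (a $ Inl 1) (b $ Inl 3) \<xi> \<eta> - wedge (a $ Inl 3) (b $ Inl 1) \<xi> \<eta>
   + wedge (a $ Inr 1) (b $ Inr 3) \<xi> \<eta> - wedge (a $ Inr 3) (b $ Inr 1) \<xi> \<eta>"
  by (simp add: wedge_mat_def K2_def block_matrix_def sum_UNIV_sum sum_3 D2_nth)

lemma wedge_mat_K3:
  "wedge_mat a K3 b \<xi> \<eta> =
     wedge (a $ Inl 2) (b $ Inl 1) \<xi> \<eta> - wedge (a $ Inl 1) (b $ Inl 2) \<xi> \<eta>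
   + wedge (a $ Inr 2) (b $ Inr 1) \<xi> \<eta> - wedge (a $ Inr 1) (b $ Inr 2) \<xi> \<eta>"
  by (simp add: wedge_mat_def K3_def block_matrix_def sum_UNIV_sum sum_3 D3_nth)

text \<open>Bilinearity moves the matrix row into the second factor, turning a flux sum into a wedge
  with a discrete spatial derivative.\<close>

lemma sum_mult_wedge:
  fixes B :: "'r::finite \<Rightarrow> real"
  shows "(\<Sum>r\<in>UNIV. B r * wedge a (b r) \<xi> \<eta>)
       = a \<xi> * (\<Sum>r\<in>UNIV. B r * b r \<eta>) - a \<eta> * (\<Sum>r\<in>UNIV. B r * b r \<xi>)"
  by (simp add: wedge_def algebra_simps sum_subtractf sum_distrib_left)

section \<open>The conservation law for a single step\<close>

lemma telescope_midpoint:
  "a' * b' - a * b = (a' - a) * midpoint_value b b' + midpoint_value a a' * (b' - b)"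
  for a b :: real
  by (simp add: midpoint_value_def field_simps)

text \<open>\<open>X\<close>, \<open>Y\<close>, \<open>Z\<close> are the discrete partial
  derivatives of the midpoint field at \<open>g\<close>, the same sums that
  \<open>sum_mult_wedge\<close> extracts from the fluxes.\<close>

lemma wavelet_step_nth:
  fixes U :: "('a::finite, 'b::finite, 'c::finite) grid_field" and i :: 'a and j :: 'b and k :: 'c
  assumes "wavelet_step \<Delta>t lam Bx By Bz w U U'"
  defines "V \<equiv> midpoint_value U U'"
  defines "X \<equiv> \<lambda>p. \<Sum>i'\<in>UNIV. Bx $ i $ i' * V $ (i', j, k) $ p"
    and "Y \<equiv> \<lambda>p. \<Sum>j'\<in>UNIV. By $ j $ j' * V $ (i, j', k) $ p"
    and "Z \<equiv> \<lambda>p. \<Sum>k'\<in>UNIV. Bz $ k $ k' * V $ (i, j, k') $ p"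
    and "g \<equiv> (i, j, k)"
  shows
    "U' $ g $ Inr 1 - U $ g $ Inr 1 = \<Delta>t * (Y (Inl 3) - Z (Inl 2)) - lam * (V $ g $ Inl 1 * w i)"
    "U' $ g $ Inr 2 - U $ g $ Inr 2 = \<Delta>t * (Z (Inl 1) - X (Inl 3)) - lam * (V $ g $ Inl 2 * w i)"
    "U' $ g $ Inr 3 - U $ g $ Inr 3 = \<Delta>t * (X (Inl 2) - Y (Inl 1)) - lam * (V $ g $ Inl 3 * w i)"
    "U' $ g $ Inl 1 - U $ g $ Inl 1 = \<Delta>t * (Z (Inr 2) - Y (Inr 3)) + lam * (V $ g $ Inr 1 * w i)"
    "U' $ g $ Inl 2 - U $ g $ Inl 2 = \<Delta>t * (X (Inr 3) - Z (Inr 1)) + lam * (V $ g $ Inr 2 * w i)"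
    "U' $ g $ Inl 3 - U $ g $ Inl 3 = \<Delta>t * (Y (Inr 1) - X (Inr 2)) + lam * (V $ g $ Inr 3 * w i)"
  using assms(1)
  unfolding wavelet_step_def Let_def V_def[symmetric] vec_eq_iff X_def Y_def Z_def g_def
  by (simp_all add: Ecomp_def Hcomp_def op1_def op2_def op3_def)

text \<open>An algebraic identity at one grid point; skew-symmetry has already done its work in
  supplying linear \<open>F\<close> and \<open>G\<close>.\<close>

lemma wavelet_step_multisymplectic:
  fixes F G :: "'s::euclidean_space \<Rightarrow> ('a::finite, 'b::finite, 'c::finite) grid_field"
  assumes "\<Delta>t \<noteq> 0" and "linear F" and "linear G"
    and step: "\<And>v. wavelet_step \<Delta>t lam Bx By Bz w (F v) (G v)"
  defines "M \<equiv> \<lambda>v. midpoint_value (F v) (G v)"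
  shows "(omega_form G u0 (i, j, k) \<xi> \<eta> - omega_form F u0 (i, j, k) \<xi> \<eta>) / \<Delta>t
      + (\<Sum>i'\<in>UNIV. Bx $ i $ i' * kappa_form K1 M u0 (i, j, k) (i', j, k) \<xi> \<eta>)
      + (\<Sum>j'\<in>UNIV. By $ j $ j' * kappa_form K2 M u0 (i, j, k) (i, j', k) \<xi> \<eta>)
      + (\<Sum>k'\<in>UNIV. Bz $ k $ k' * kappa_form K3 M u0 (i, j, k) (i, j, k') \<xi> \<eta>) = 0"
proof -
  let ?g = "(i, j, k)"
  have M: "linear M"
    by (rule linearI)
      (simp_all add: M_def midpoint_value_def linear_add[OF \<open>linear F\<close>] linear_add[OF \<open>linear G\<close>]
        linear_cmul[OF \<open>linear F\<close>] linear_cmul[OF \<open>linear G\<close>] algebra_simps)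
  define X where "X v p = (\<Sum>i'\<in>UNIV. Bx $ i $ i' * M v $ (i', j, k) $ p)" for v p
  define Y where "Y v p = (\<Sum>j'\<in>UNIV. By $ j $ j' * M v $ (i, j', k) $ p)" for v p
  define Z where "Z v p = (\<Sum>k'\<in>UNIV. Bz $ k $ k' * M v $ (i, j, k') $ p)" for v p
  define m where "m v p = M v $ ?g $ p" for v p
  have mid: "midpoint_value (F v $ ?g $ p) (G v $ ?g $ p) = m v p" for v p
    by (simp add: m_def M_def midpoint_value_def)
  have "midpoint_value (F v) (G v) = M v" for v
    by (simp add: M_def)
  \<comment> \<open>By linearity, the scheme started from a tangent vector is the variational scheme
    along it; \<open>S\<close> is used below at \<open>\<xi>\<close> and
    \<open>\<eta>\<close>.\<close>
  note S = wavelet_step_nth[OF step, where i = i and j = j and k = k, unfolded this,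
      folded X_def Y_def Z_def m_def]
  have om: "omega_form G u0 ?g \<xi> \<eta> - omega_form F u0 ?g \<xi> \<eta> =
    (\<Sum>s\<in>UNIV. (G \<xi> $ ?g $ Inr s - F \<xi> $ ?g $ Inr s) * m \<eta> (Inl s)
        + m \<xi> (Inr s) * (G \<eta> $ ?g $ Inl s - F \<eta> $ ?g $ Inl s)
        - (G \<eta> $ ?g $ Inr s - F \<eta> $ ?g $ Inr s) * m \<xi> (Inl s)
        - m \<eta> (Inr s) * (G \<xi> $ ?g $ Inl s - F \<xi> $ ?g $ Inl s))"
  proof -
    have "omega_form G u0 ?g \<xi> \<eta> - omega_form F u0 ?g \<xi> \<eta> =
      (\<Sum>s\<in>UNIV. (G \<xi> $ ?g $ Inr s * G \<eta> $ ?g $ Inl s - F \<xi> $ ?g $ Inr s * F \<eta> $ ?g $ Inl s)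
        - (G \<eta> $ ?g $ Inr s * G \<xi> $ ?g $ Inl s - F \<eta> $ ?g $ Inr s * F \<xi> $ ?g $ Inl s))"
      by (simp add: omega_form_def wedge_mat_Mmat differential_linear[OF \<open>linear F\<close>]
          differential_linear[OF \<open>linear G\<close>] wedge_def sum_3)
        (simp add: field_simps)
    then show ?thesis
      by (simp only: telescope_midpoint mid) (simp add: algebra_simps)
  qed
  have kx: "(\<Sum>i'\<in>UNIV. Bx $ i $ i' * kappa_form K1 M u0 ?g (i', j, k) \<xi> \<eta>) =
      (m \<xi> (Inl 3) * X \<eta> (Inl 2) - m \<eta> (Inl 3) * X \<xi> (Inl 2))
    - (m \<xi> (Inl 2) * X \<eta> (Inl 3) - m \<eta> (Inl 2) * X \<xi> (Inl 3))
    + (m \<xi> (Inr 3) * X \<eta> (Inr 2) - m \<eta> (Inr 3) * X \<xi> (Inr 2))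
    - (m \<xi> (Inr 2) * X \<eta> (Inr 3) - m \<eta> (Inr 2) * X \<xi> (Inr 3))"
    by (simp only: kappa_form_def wedge_mat_K1 differential_linear[OF M] X_def m_def
        sum_mult_wedge distrib_left right_diff_distrib sum.distrib sum_subtractf)
  have ky: "(\<Sum>j'\<in>UNIV. By $ j $ j' * kappa_form K2 M u0 ?g (i, j', k) \<xi> \<eta>) =
      (m \<xi> (Inl 1) * Y \<eta> (Inl 3) - m \<eta> (Inl 1) * Y \<xi> (Inl 3))
    - (m \<xi> (Inl 3) * Y \<eta> (Inl 1) - m \<eta> (Inl 3) * Y \<xi> (Inl 1))
    + (m \<xi> (Inr 1) * Y \<eta> (Inr 3) - m \<eta> (Inr 1) * Y \<xi> (Inr 3))
    - (m \<xi> (Inr 3) * Y \<eta> (Inr 1) - m \<eta> (Inr 3) * Y \<xi> (Inr 1))"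
    by (simp only: kappa_form_def wedge_mat_K2 differential_linear[OF M] Y_def m_def
        sum_mult_wedge distrib_left right_diff_distrib sum.distrib sum_subtractf)
  have kz: "(\<Sum>k'\<in>UNIV. Bz $ k $ k' * kappa_form K3 M u0 ?g (i, j, k') \<xi> \<eta>) =
      (m \<xi> (Inl 2) * Z \<eta> (Inl 1) - m \<eta> (Inl 2) * Z \<xi> (Inl 1))
    - (m \<xi> (Inl 1) * Z \<eta> (Inl 2) - m \<eta> (Inl 1) * Z \<xi> (Inl 2))
    + (m \<xi> (Inr 2) * Z \<eta> (Inr 1) - m \<eta> (Inr 2) * Z \<xi> (Inr 1))
    - (m \<xi> (Inr 1) * Z \<eta> (Inr 2) - m \<eta> (Inr 1) * Z \<xi> (Inr 2))"
    by (simp only: kappa_form_def wedge_mat_K3 differential_linear[OF M] Z_def m_def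
        sum_mult_wedge distrib_left right_diff_distrib sum.distrib sum_subtractf)
  \<comment> \<open>After inserting \<open>S\<close>, the noise leaves multiples of wedges of a
    midpoint one-form with itself, which vanish; the terms with \<open>\<Delta>t\<close> are the
    negated flux sums.\<close>
  show ?thesis
    using \<open>\<Delta>t \<noteq> 0\<close> unfolding om kx ky kz sum_3 S
    by (simp add: field_simps)
qed

theorem theorem3p1:
  fixes \<gamma> J1 J2 J3 :: nat and L1 L2 L3 :: real
    and \<phi> \<theta> :: "real \<Rightarrow> real"
    and \<Delta>t lam :: real
    and P :: "'w measure"
    and dW :: "nat \<Rightarrow> 'a::finite \<Rightarrow> 'w \<Rightarrow> real"
    and u :: "nat \<Rightarrow> 'w \<Rightarrow> ('a, 'b::finite, 'c::finite) grid_field \<Rightarrow> ('a, 'b, 'c) grid_field"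
    and Bx :: "real^'a^'a" and By :: "real^'b^'b" and Bz :: "real^'c^'c"
    and n :: nat and \<omega> :: 'w and u0 :: "('a, 'b, 'c) grid_field"
    and i j k :: int
    and \<xi> \<eta> :: "('a, 'b, 'c) grid_field"
  defines "Bx \<equiv> diff_matrix \<theta> \<gamma> J1"
    and "By \<equiv> diff_matrix \<theta> \<gamma> J2"
    and "Bz \<equiv> diff_matrix \<theta> \<gamma> J3"
  defines "uhalf \<equiv> (\<lambda>v. midpoint_value (u n \<omega> v) (u (Suc n) \<omega> v))"
  assumes "\<gamma> > 0" and "even \<gamma>"
    and "daubechies_scaling_function \<gamma> \<phi>"
    and "\<theta> = autocorrelation \<phi>"
    and "\<And>x. \<theta> differentiable (at x)"
    and "real CARD('a) = L1 * 2 ^ J1"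
    and "real CARD('b) = L2 * 2 ^ J2"
    and "real CARD('c) = L3 * 2 ^ J3"
    and "2 * \<gamma> - 1 \<le> CARD('a)" and "2 * \<gamma> - 1 \<le> CARD('b)" and "2 * \<gamma> - 1 \<le> CARD('c)"
    and "\<Delta>t > 0" and "lam \<ge> 0"
    and "prob_space P"
    and "\<And>m r. dW m r \<in> borel_measurable P"
    and initial: "\<And>\<omega> v. \<omega> \<in> space P \<Longrightarrow> u 0 \<omega> v = v"
    and scheme: "\<And>m \<omega> v. \<omega> \<in> space P \<Longrightarrow>
      wavelet_step \<Delta>t lam Bx By Bz (\<lambda>r. dW m r \<omega>) (u m \<omega> v) (u (Suc m) \<omega> v)"
    and "\<omega> \<in> space P"
    and "i \<in> {1..int CARD('a)}" and "j \<in> {1..int CARD('b)}" and "k \<in> {1..int CARD('c)}"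
  shows
    "(omega_form (u (Suc n) \<omega>) u0 (grid_pt i, grid_pt j, grid_pt k) \<xi> \<eta>
        - omega_form (u n \<omega>) u0 (grid_pt i, grid_pt j, grid_pt k) \<xi> \<eta>) / \<Delta>t
      + (\<Sum>i' = i - (int \<gamma> - 1)..i + (int \<gamma> - 1). Bx $ grid_pt i $ grid_pt i' *
          kappa_form K1 uhalf u0
            (grid_pt i, grid_pt j, grid_pt k) (grid_pt i', grid_pt j, grid_pt k) \<xi> \<eta>)
      + (\<Sum>j' = j - (int \<gamma> - 1)..j + (int \<gamma> - 1). By $ grid_pt j $ grid_pt j' *
          kappa_form K2 uhalf u0
            (grid_pt i, grid_pt j, grid_pt k) (grid_pt i, grid_pt j', grid_pt k) \<xi> \<eta>)
      + (\<Sum>k' = k - (int \<gamma> - 1)..k + (int \<gamma> - 1). Bz $ grid_pt k $ grid_pt k' *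
          kappa_form K3 uhalf u0
            (grid_pt i, grid_pt j, grid_pt k) (grid_pt i, grid_pt j, grid_pt k') \<xi> \<eta>) = 0"
proof -
  have even: "\<theta> (- x) = \<theta> x" for x
    by (simp add: \<open>\<theta> = autocorrelation \<phi>\<close> autocorrelation_minus)
  have odd: "deriv \<theta> (- x) = - deriv \<theta> x" for x
    by (intro deriv_even_minus even \<open>\<And>x. \<theta> differentiable (at x)\<close>)
  have skew: "Bx $ s $ r = - Bx $ r $ s" "By $ s' $ r' = - By $ r' $ s'"
    "Bz $ s'' $ r'' = - Bz $ r'' $ s''" for r s r' s' r'' s''
    unfolding Bx_def By_def Bz_def
    by (intro diff_matrix_skew[OF odd] \<open>2 * \<gamma> - 1 \<le> CARD('a)\<close> \<open>2 * \<gamma> - 1 \<le> CARD('b)\<close>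
        \<open>2 * \<gamma> - 1 \<le> CARD('c)\<close>)+
  \<comment> \<open>For fixed \<open>\<omega>\<close> the increments are the same for all initial
    data, so linearity passes from step to step, starting from the identity.\<close>
  have lin: "linear (u m \<omega>)" for m
  proof (induction m)
    case 0
    have "u 0 \<omega> = id"
      using initial[OF \<open>\<omega> \<in> space P\<close>] by auto
    then show ?case
      by (simp add: linear_ident)
  next
    case (Suc m)
    then show ?case
      by (rule wavelet_step_linear[OF _ scheme[OF \<open>\<omega> \<in> space P\<close>] skew])
  qed
  \<comment> \<open>Each flux is viewed as a function of its summation point alone, so that the band
    lemma yields the full sums of the single-step law.\<close>
  note bandx = sum_diff_matrix_band[OF \<open>\<gamma> > 0\<close> \<open>2 * \<gamma> - 1 \<le> CARD('a)\<close> \<open>i \<in> {1..int CARD('a)}\<close>,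
      of \<theta> J1 "\<lambda>r. kappa_form K1 uhalf u0 (grid_pt i, grid_pt j, grid_pt k)
        (r, grid_pt j, grid_pt k) \<xi> \<eta>", folded Bx_def]
  note bandy = sum_diff_matrix_band[OF \<open>\<gamma> > 0\<close> \<open>2 * \<gamma> - 1 \<le> CARD('b)\<close> \<open>j \<in> {1..int CARD('b)}\<close>,
      of \<theta> J2 "\<lambda>r. kappa_form K2 uhalf u0 (grid_pt i, grid_pt j, grid_pt k)
        (grid_pt i, r, grid_pt k) \<xi> \<eta>", folded By_def]
  note bandz = sum_diff_matrix_band[OF \<open>\<gamma> > 0\<close> \<open>2 * \<gamma> - 1 \<le> CARD('c)\<close> \<open>k \<in> {1..int CARD('c)}\<close>,
      of \<theta> J3 "\<lambda>r. kappa_form K3 uhalf u0 (grid_pt i, grid_pt j, grid_pt k)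
        (grid_pt i, grid_pt j, r) \<xi> \<eta>", folded Bz_def]
  have "\<Delta>t \<noteq> 0"
    using \<open>\<Delta>t > 0\<close> by simp
  then show ?thesis
    unfolding bandx bandy bandz unfolding uhalf_def
    by (rule wavelet_step_multisymplectic[OF _ lin lin scheme[OF \<open>\<omega> \<in> space P\<close>]])
qed

end
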